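(* Let a consistent class of data with base $X$, locally compact space $Y$, Radon measure $\mu$ on $Y$, family $\{\mathfrak E_x\}_{x\in X}$, topologies $\{\tau_x\}_{x\in X}$, space $\langle\mathcal H,\mathfrak T\rangle$ and linear space $\mathcal A$ be given, and let $\mathfrak G$ be the locally convex space relative to it and $\Psi_Y^{\mathcal H}$ the associated map (see context). Then: (1) $\Psi_Y^{\mathcal H}$ restricts to a linear map from $\mathfrak L_1(Y,\mathfrak G,\mu)$ into $\prod_{x\in X}\mathfrak L_1(Y,\langle\mathcal L(\mathfrak E_x),\tau_x\rangle,\mu)$; (2) for all $x\in X$ and all $\overline F\in\mathfrak L_1(Y,\mathfrak G,\mu)$ $$\int\Pr_x(\Psi_Y^{\mathcal H}(\overline F))(s)\,d\mu(s)=\Pr_x\circ\Bigl(\int\overline F(s)\,d\mu(s)\Bigr)\circ\imath_x .$$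
   Context: Hlcs means Hausdorff locally convex space (over $\mathbb C$); $\mathcal L(E)$ denotes the continuous, $End(E)$ all linear endomorphisms of $E$. For $Y$ locally compact, $\mu$ a Radon measure, $E$ a Hlcs, $\mathfrak L_1(Y,E,\mu)$ is the space of scalarly essentially $\mu$-integrable maps $Y\to E$ whose (weak) integral belongs to $E$ (Bourbaki). For a family of vector spaces $\{Z_x\}_{x\in X}$, $\Pr_x:\prod_yZ_y\to Z_x$ is the projection and $\imath_x:Z_x\to\prod_yZ_y$ the canonical injection (zero in all other coordinates). Consistent class of data: a set $X$, a locally compact space $Y$ with a Radon measure $\mu$, Hlcs $\mathfrak E_x$ ($x\in X$) with fundamental sets of seminorms, topologies $\tau_x$ making $\langle\mathcal L(\mathfrak E_x),\tau_x\rangle$ a Hlcs (with fundamental sets of seminorms), and a Hlcs $\langle\mathcal H,\mathfrak T\rangle$ such that: $\mathcal H$ is a linear subspace of $\prod_x\mathfrak E_x$; $\imath_x(\mathfrak E_x)\subset\mathcal H$ for all $x$; $\Pr_x:\langle\mathcal H,\mathfrak T\rangle\to\mathfrak E_x$ and $\imath_x:\mathfrak E_x\to\langle\mathcal H,\mathfrak T\rangle$ are continuous for all $x$; and $\mathcal A\subseteq\prod_x\mathcal L(\mathfrak E_x)$ is a linear subspace with $\theta(u)|_{\mathcal H}\in\mathcal L(\langle\mathcal H,\mathfrak T\rangle)$ for all $u\in\mathcal A$ and $\imath_x(\mathcal L(\mathfrak E_x))\subseteq\mathcal A$ for all $x$. Here $\theta:\prod_xEnd(\mathfrak E_x)\to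 End(\prod_x\mathfrak E_x)$ is given by $\Pr_x\circ\theta(u)=\Pr_x(u)\circ\Pr_x$. $\mathfrak G$ is the vector space $G=\{\theta(u)|_{\mathcal H}:u\in\mathcal A\}$ with the finest locally convex topology making all maps $h_x:\langle\mathcal L(\mathfrak E_x),\tau_x\rangle\to G$, $h_x(f)=(\imath_x\circ f\circ\Pr_x)|_{\mathcal H}$, continuous. $\Psi_Y^{\mathcal H}:End(\mathcal H)^Y\to\prod_xEnd(\mathfrak E_x)^Y$ is given by $\Psi_Y^{\mathcal H}(\overline F)(x)(s)=\Pr_x\circ\overline F(s)\circ\imath_x$. *)

theory Defs
  imports "HOL-Analysis.Analysis" "HOL-Library.Function_Algebras"
begin

section \<open>Complex vector spaces\<close>

class complex_vector = real_vector +
  fixes scaleC :: "complex \<Rightarrow> 'a \<Rightarrow> 'a" (infixr \<open>*\<^sub>C\<close> 75)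
  assumes scaleC_add_right: "c *\<^sub>C (x + y) = c *\<^sub>C x + c *\<^sub>C y"
    and scaleC_add_left: "(c + d) *\<^sub>C x = c *\<^sub>C x + d *\<^sub>C x"
    and scaleC_scaleC: "c *\<^sub>C d *\<^sub>C x = (c * d) *\<^sub>C x"
    and scaleC_one: "1 *\<^sub>C x = x"
    and scaleR_scaleC: "r *\<^sub>R x = complex_of_real r *\<^sub>C x"

global_interpretation complex_vector:
  vector_space "scaleC :: complex \<Rightarrow> 'a \<Rightarrow> 'a::complex_vector"
  by standard (simp_all add: scaleC_add_right scaleC_add_left scaleC_scaleC scaleC_one)

instantiation complex :: complex_vector
begin

definition scaleC_complex :: "complex \<Rightarrow> complex \<Rightarrow> complex" where
  "scaleC_complex c z = c * z"

instance
  by standard (simp_all add: scaleC_complex_def algebra_simps scaleR_conv_of_real)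

end

instantiation "fun" :: (type, real_vector) real_vector
begin

definition scaleR_fun :: "real \<Rightarrow> ('a \<Rightarrow> 'b) \<Rightarrow> 'a \<Rightarrow> 'b" where
  "scaleR_fun r f = (\<lambda>x. r *\<^sub>R f x)"

instance
  by standard (simp_all add: scaleR_fun_def fun_eq_iff scaleR_add_right scaleR_add_left)

end

instantiation "fun" :: (type, complex_vector) complex_vector
begin

definition scaleC_fun :: "complex \<Rightarrow> ('a \<Rightarrow> 'b) \<Rightarrow> 'a \<Rightarrow> 'b" where
  "scaleC_fun c f = (\<lambda>x. c *\<^sub>C f x)"

instance
  by standard (simp_all add: scaleC_fun_def scaleR_fun_def fun_eq_iff
      scaleC_add_right scaleC_add_left scaleC_scaleC scaleC_one scaleR_scaleC)

end

text \<open>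
  Vector spaces are carried by linear subspaces of types of class \<^class>\<open>complex_vector\<close>.
  A map defined on a carrier \<open>S\<close> is represented by the total function that extends it by
  \<open>0\<close> outside \<open>S\<close>; pointwise sums and multiples of such functions are again of this form, so
  the space of maps out of \<open>S\<close> is a linear subspace of the function type.
\<close>

definition zero_ext :: "'a set \<Rightarrow> ('a \<Rightarrow> 'b) \<Rightarrow> 'a \<Rightarrow> 'b::zero" where
  "zero_ext S f = (\<lambda>v. if v \<in> S then f v else 0)"

definition clinear_on :: "'a::complex_vector set \<Rightarrow> ('a \<Rightarrow> 'b::complex_vector) \<Rightarrow> bool" where
  "clinear_on S f \<longleftrightarrow>
     (\<forall>v\<in>S. \<forall>w\<in>S. f (v + w) = f v + f w) \<and> (\<forall>c. \<forall>v\<in>S. f (c *\<^sub>C v) = c *\<^sub>C f v)"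

definition End_space :: "'a::complex_vector set \<Rightarrow> ('a \<Rightarrow> 'a) set" where
  "End_space S = {f. clinear_on S f \<and> f ` S \<subseteq> S \<and> (\<forall>v. v \<notin> S \<longrightarrow> f v = 0)}"

definition prod_space :: "'x set \<Rightarrow> ('x \<Rightarrow> 'a::zero set) \<Rightarrow> ('x \<Rightarrow> 'a) set" where
  "prod_space X Z = {f. (\<forall>x\<in>X. f x \<in> Z x) \<and> (\<forall>x. x \<notin> X \<longrightarrow> f x = 0)}"

definition Proj :: "'x \<Rightarrow> ('x \<Rightarrow> 'a) \<Rightarrow> 'a" where
  "Proj x f = f x"

definition inj_coord :: "'x \<Rightarrow> 'a::zero \<Rightarrow> 'x \<Rightarrow> 'a" where
  "inj_coord x v = (\<lambda>y. if y = x then v else 0)"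

section \<open>Locally convex spaces\<close>

definition lcs :: "'a::complex_vector topology \<Rightarrow> bool" where
  "lcs T \<longleftrightarrow>
     complex_vector.subspace (topspace T) \<and>
     continuous_map (prod_topology T T) T (\<lambda>(v, w). v + w) \<and>
     continuous_map (prod_topology euclidean T) T (\<lambda>(c, v). c *\<^sub>C v) \<and>
     (\<forall>U. openin T U \<and> 0 \<in> U \<longrightarrow> (\<exists>V. openin T V \<and> convex V \<and> 0 \<in> V \<and> V \<subseteq> U))"

definition hlcs :: "'a::complex_vector topology \<Rightarrow> bool" where
  "hlcs T \<longleftrightarrow> lcs T \<and> Hausdorff_space T"

definition seminorm_on :: "'a::complex_vector set \<Rightarrow> ('a \<Rightarrow> real) \<Rightarrow> bool" where
  "seminorm_on S p \<longleftrightarrow>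
     (\<forall>v\<in>S. 0 \<le> p v) \<and> (\<forall>v\<in>S. \<forall>w\<in>S. p (v + w) \<le> p v + p w) \<and>
     (\<forall>c. \<forall>v\<in>S. p (c *\<^sub>C v) = cmod c * p v)"

definition fundamental_seminorms ::
    "'a::complex_vector topology \<Rightarrow> ('a \<Rightarrow> real) set \<Rightarrow> bool" where
  "fundamental_seminorms T N \<longleftrightarrow>
     (\<forall>p\<in>N. seminorm_on (topspace T) p) \<and>
     (\<forall>U. openin T U \<longleftrightarrow> U \<subseteq> topspace T \<and>
        (\<forall>v\<in>U. \<exists>P e. finite P \<and> P \<subseteq> N \<and> 0 < e \<and>
           {w \<in> topspace T. \<forall>p\<in>P. p (w - v) < e} \<subseteq> U))"

definition L_space :: "'a::complex_vector topology \<Rightarrow> ('a \<Rightarrow> 'a) set" where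
  "L_space T = {f \<in> End_space (topspace T). continuous_map T T f}"

definition dual_space :: "'a::complex_vector topology \<Rightarrow> ('a \<Rightarrow> complex) set" where
  "dual_space T = {\<phi>. clinear_on (topspace T) \<phi> \<and> continuous_map T euclidean \<phi> \<and>
     (\<forall>v. v \<notin> topspace T \<longrightarrow> \<phi> v = 0)}"

definition lcs_topologies_for ::
    "'a::complex_vector set \<Rightarrow> 'i set \<Rightarrow> ('i \<Rightarrow> 'b topology) \<Rightarrow> ('i \<Rightarrow> 'b \<Rightarrow> 'a) \<Rightarrow>
     'a topology set" where
  "lcs_topologies_for S I T h =
     {R. lcs R \<and> topspace R = S \<and> (\<forall>i\<in>I. continuous_map (T i) R (h i))}"

text \<open>
  The supremum of all locally convex topologies on \<open>S\<close> making the maps \<open>h i\<close> continuous. It is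
  itself such a topology, hence the finest one; see the lemmas below.
\<close>

definition finest_lcs_topology ::
    "'a::complex_vector set \<Rightarrow> 'i set \<Rightarrow> ('i \<Rightarrow> 'b topology) \<Rightarrow> ('i \<Rightarrow> 'b \<Rightarrow> 'a) \<Rightarrow>
     'a topology" where
  "finest_lcs_topology S I T h =
     topology_generated_by (\<Union>R\<in>lcs_topologies_for S I T h. {U. openin R U})"

lemma finest_lcs_topology_finest:
  assumes "R \<in> lcs_topologies_for S I T h" "openin R U"
  shows "openin (finest_lcs_topology S I T h) U"
  unfolding finest_lcs_topology_def
  by (rule topology_generated_by_Basis) (use assms in blast)

lemma lcs_indiscrete:
  fixes S :: "'a::complex_vector set"
  assumes S: "complex_vector.subspace S"
  shows "lcs (topology (\<lambda>U. U = {} \<or> U = S))" "topspace (topology (\<lambda>U. U = {} \<or> U = S)) = S"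
    "h \<in> topspace T' \<rightarrow> S \<Longrightarrow> continuous_map T' (topology (\<lambda>U. U = {} \<or> U = S)) h"
proof -
  let ?T = "topology (\<lambda>U. U = {} \<or> U = S)"
  have "istopology (\<lambda>U. U = {} \<or> U = S)"
    unfolding istopology_def by auto
  then have op: "openin ?T U \<longleftrightarrow> U = {} \<or> U = S" for U
    by (simp add: topology_inverse')
  show ts: "topspace ?T = S"
    unfolding topspace_def op by auto
  have cont: "continuous_map T2 ?T g" if "g \<in> topspace T2 \<rightarrow> S" for T2 :: "'c topology" and g
  proof -
    have "{x \<in> topspace T2. g x \<in> S} = topspace T2" using that by auto
    then show ?thesis
      unfolding continuous_map_def ts op using that by auto
  qed
  then show "h \<in> topspace T' \<rightarrow> S \<Longrightarrow> continuous_map T' ?T h" .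
  have sub: "0 \<in> S" "\<And>v w. v \<in> S \<Longrightarrow> w \<in> S \<Longrightarrow> v + w \<in> S" "\<And>c v. v \<in> S \<Longrightarrow> c *\<^sub>C v \<in> S"
    using S by (auto simp: complex_vector.subspace_def)
  have "convex S"
    unfolding convex_def by (auto simp: scaleR_scaleC intro!: sub)
  moreover have "continuous_map (prod_topology ?T ?T) ?T (\<lambda>(v, w). v + w)"
    by (rule cont) (auto simp: ts sub)
  moreover have "continuous_map (prod_topology euclidean ?T) ?T (\<lambda>(c, v). c *\<^sub>C v)"
    by (rule cont) (auto simp: ts sub)
  ultimately show "lcs ?T"
    unfolding lcs_def ts op using S sub(1) by auto
qed

lemma lcs_finest_lcs_topology:
  assumes S: "complex_vector.subspace S" and h: "\<And>i. i \<in> I \<Longrightarrow> h i \<in> topspace (T i) \<rightarrow> S"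
  shows "finest_lcs_topology S I T h \<in> lcs_topologies_for S I T h"
proof -
  let ?C = "lcs_topologies_for S I T h"
  let ?B = "\<Union>R\<in>?C. {U. openin R U}"
  let ?F = "finest_lcs_topology S I T h"
  have ind: "topology (\<lambda>U. U = {} \<or> U = S) \<in> ?C"
    unfolding lcs_topologies_for_def
    by (simp add: lcs_indiscrete(1,2)[OF S]) (intro ballI lcs_indiscrete(3)[OF S] h)
  have R: "lcs R" "topspace R = S" "\<And>i. i \<in> I \<Longrightarrow> continuous_map (T i) R (h i)"
    if "R \<in> ?C" for R
    using that by (auto simp: lcs_topologies_for_def)
  have ts: "topspace ?F = S"
  proof
    show "topspace ?F \<subseteq> S"
      unfolding finest_lcs_topology_def using R(2) openin_subset by fastforce
    show "S \<subseteq> topspace ?F"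
      using finest_lcs_topology_finest[OF ind] lcs_indiscrete(2)[OF S]
      by (metis openin_subset openin_topspace)
  qed
  have UB: "\<Union>?B = S"
    using ts unfolding finest_lcs_topology_def by simp
  have fine: "continuous_map ?F R id" if "R \<in> ?C" for R
    unfolding continuous_map_def
  proof (intro conjI allI impI)
    show "id \<in> topspace ?F \<rightarrow> topspace R" using ts R(2)[OF that] by auto
    fix U assume "openin R U"
    moreover have "{x \<in> topspace ?F. id x \<in> U} = U"
      using ts R(2)[OF that] openin_subset[OF \<open>openin R U\<close>] by auto
    ultimately show "openin ?F {x \<in> topspace ?F. id x \<in> U}"
      using finest_lcs_topology_finest[OF that] by simp
  qed
  have into: "continuous_map Z ?F g" if "\<And>R. R \<in> ?C \<Longrightarrow> continuous_map Z R g"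
    for Z :: "'z topology" and g
    unfolding finest_lcs_topology_def continuous_on_generated_topo_iff
  proof (intro conjI allI impI)
    show "g ` topspace Z \<subseteq> \<Union>?B"
      unfolding UB using that[OF ind] R(2)[OF ind] by (auto simp: continuous_map_def)
    fix U assume "U \<in> ?B"
    then obtain R' where "R' \<in> ?C" "openin R' U" by auto
    then have "openin Z {x \<in> topspace Z. g x \<in> U}"
      using that by (simp add: continuous_map_def)
    moreover have "{x \<in> topspace Z. g x \<in> U} = g -` U \<inter> topspace Z" by auto
    ultimately show "openin Z (g -` U \<inter> topspace Z)" by simp
  qed
  have add: "continuous_map (prod_topology ?F ?F) ?F (\<lambda>(v, w). v + w)"
  proof (rule into)
    fix R' assume R': "R' \<in> ?C"
    have "continuous_map (prod_topology ?F ?F) (prod_topology R' R') (\<lambda>(v, w). (id v, id w))"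
      by (rule continuous_map_prod_top[THEN iffD2]) (simp add: fine[OF R', unfolded id_def])
    moreover have "continuous_map (prod_topology R' R') R' (\<lambda>(v, w). v + w)"
      using R(1)[OF R'] by (simp add: lcs_def)
    ultimately show "continuous_map (prod_topology ?F ?F) R' (\<lambda>(v, w). v + w)"
      by (auto dest: continuous_map_compose simp: o_def case_prod_unfold)
  qed
  have scale: "continuous_map (prod_topology euclidean ?F) ?F (\<lambda>(c, v). c *\<^sub>C v)"
  proof (rule into)
    fix R' assume R': "R' \<in> ?C"
    have "continuous_map (prod_topology euclidean ?F) (prod_topology euclidean R')
        (\<lambda>(c, v). (id c :: complex, id v))"
      by (rule continuous_map_prod_top[THEN iffD2]) (simp add: fine[OF R', unfolded id_def])
    moreover have "continuous_map (prod_topology euclidean R') R' (\<lambda>(c, v). c *\<^sub>C v)"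
      using R(1)[OF R'] by (simp add: lcs_def)
    ultimately show "continuous_map (prod_topology euclidean ?F) R' (\<lambda>(c, v). c *\<^sub>C v)"
      by (auto dest: continuous_map_compose simp: o_def case_prod_unfold)
  qed
  have base: "\<exists>V. openin ?F V \<and> convex V \<and> 0 \<in> V \<and> V \<subseteq> U" if "openin ?F U" "0 \<in> U" for U
  proof -
    have "generate_topology_on ?B U"
      using that(1) unfolding finest_lcs_topology_def by (rule openin_topology_generated_by)
    then show ?thesis using that(2)
    proof (induction rule: generate_topology_on.induct)
      case Empty
      then show ?case by simp
    next
      case (Int a b)
      then obtain V W where "openin ?F V" "convex V" "0 \<in> V" "V \<subseteq> a"
        "openin ?F W" "convex W" "0 \<in> W" "W \<subseteq> b" by blast
      then show ?case
        by (intro exI[of _ "V \<inter> W"]) (auto intro: convex_Int)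
    next
      case (UN K)
      then show ?case by (meson Sup_upper UnionE subset_trans)
    next
      case (Basis s)
      then obtain R' where R': "R' \<in> ?C" "openin R' s" by auto
      then obtain V where "openin R' V" "convex V" "0 \<in> V" "V \<subseteq> s"
        using R(1)[OF R'(1)] Basis(2) unfolding lcs_def by blast
      then show ?case using finest_lcs_topology_finest[OF R'(1)] by blast
    qed
  qed
  have "lcs ?F"
    unfolding lcs_def ts using S add scale base by auto
  then show ?thesis
    unfolding lcs_topologies_for_def by (simp add: ts) (intro ballI into R(3))
qed

section \<open>Integration with respect to Radon measures\<close>

text \<open>
  Radon measures and their integrals are those of Bourbaki: a Radon measure is a complex linear
  form on the space of continuous functions with compact support, continuous for the sup norm on
  the functions supported in any fixed compact set.
\<close>

definition Kc :: "'y topology \<Rightarrow> ('y \<Rightarrow> complex) set" where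
  "Kc Y = {f. continuous_map Y euclidean f \<and>
     compactin Y (Y closure_of {y \<in> topspace Y. f y \<noteq> 0}) \<and> (\<forall>y. y \<notin> topspace Y \<longrightarrow> f y = 0)}"

definition radon_measure :: "'y topology \<Rightarrow> (('y \<Rightarrow> complex) \<Rightarrow> complex) \<Rightarrow> bool" where
  "radon_measure Y \<mu> \<longleftrightarrow> clinear_on (Kc Y) \<mu> \<and>
     (\<forall>C. compactin Y C \<longrightarrow> (\<exists>M. \<forall>f\<in>Kc Y. (Y closure_of {y \<in> topspace Y. f y \<noteq> 0}) \<subseteq> C \<longrightarrow>
        cmod (\<mu> f) \<le> M * (SUP y. cmod (f y))))"

definition Kc_nonneg :: "'y topology \<Rightarrow> ('y \<Rightarrow> real) set" where
  "Kc_nonneg Y = {f. (\<lambda>y. complex_of_real (f y)) \<in> Kc Y \<and> (\<forall>y. 0 \<le> f y)}"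

text \<open>The absolute value of \<open>\<mu>\<close> on \<^const>\<open>Kc_nonneg\<close>.\<close>

definition abs_radon ::
    "'y topology \<Rightarrow> (('y \<Rightarrow> complex) \<Rightarrow> complex) \<Rightarrow> ('y \<Rightarrow> real) \<Rightarrow> ennreal" where
  "abs_radon Y \<mu> f = (SUP g\<in>{g \<in> Kc Y. \<forall>y. cmod (g y) \<le> f y}. ennreal (cmod (\<mu> g)))"

definition lower_semicont :: "'y topology \<Rightarrow> ('y \<Rightarrow> ennreal) \<Rightarrow> bool" where
  "lower_semicont Y h \<longleftrightarrow> (\<forall>a. openin Y {y \<in> topspace Y. a < h y})"

definition upper_integral_lsc ::
    "'y topology \<Rightarrow> (('y \<Rightarrow> complex) \<Rightarrow> complex) \<Rightarrow> ('y \<Rightarrow> ennreal) \<Rightarrow> ennreal" where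
  "upper_integral_lsc Y \<mu> h =
     (SUP f\<in>{f \<in> Kc_nonneg Y. \<forall>y\<in>topspace Y. ennreal (f y) \<le> h y}. abs_radon Y \<mu> f)"

definition upper_integral ::
    "'y topology \<Rightarrow> (('y \<Rightarrow> complex) \<Rightarrow> complex) \<Rightarrow> ('y \<Rightarrow> ennreal) \<Rightarrow> ennreal" where
  "upper_integral Y \<mu> f =
     (INF h\<in>{h. lower_semicont Y h \<and> (\<forall>y\<in>topspace Y. f y \<le> h y)}. upper_integral_lsc Y \<mu> h)"

definition L1_approx ::
    "'y topology \<Rightarrow> (('y \<Rightarrow> complex) \<Rightarrow> complex) \<Rightarrow> ('y \<Rightarrow> complex) \<Rightarrow> (nat \<Rightarrow> 'y \<Rightarrow> complex) \<Rightarrow>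
     bool" where
  "L1_approx Y \<mu> f g \<longleftrightarrow> (\<forall>n. g n \<in> Kc Y) \<and>
     (\<lambda>n. upper_integral Y \<mu> (\<lambda>y. ennreal (cmod (f y - g n y)))) \<longlonglongrightarrow> 0"

definition radon_integrable ::
    "'y topology \<Rightarrow> (('y \<Rightarrow> complex) \<Rightarrow> complex) \<Rightarrow> ('y \<Rightarrow> complex) \<Rightarrow> bool" where
  "radon_integrable Y \<mu> f \<longleftrightarrow> (\<exists>g. L1_approx Y \<mu> f g)"

definition radon_integral ::
    "'y topology \<Rightarrow> (('y \<Rightarrow> complex) \<Rightarrow> complex) \<Rightarrow> ('y \<Rightarrow> complex) \<Rightarrow> complex" where
  "radon_integral Y \<mu> f = (THE I. \<exists>g. L1_approx Y \<mu> f g \<and> (\<lambda>n. \<mu> (g n)) \<longlonglongrightarrow> I)"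

definition locally_negligible ::
    "'y topology \<Rightarrow> (('y \<Rightarrow> complex) \<Rightarrow> complex) \<Rightarrow> 'y set \<Rightarrow> bool" where
  "locally_negligible Y \<mu> N \<longleftrightarrow>
     (\<forall>C. compactin Y C \<longrightarrow> upper_integral Y \<mu> (indicator (N \<inter> C)) = 0)"

definition ess_version ::
    "'y topology \<Rightarrow> (('y \<Rightarrow> complex) \<Rightarrow> complex) \<Rightarrow> ('y \<Rightarrow> complex) \<Rightarrow> ('y \<Rightarrow> complex) \<Rightarrow> bool" where
  "ess_version Y \<mu> f g \<longleftrightarrow>
     radon_integrable Y \<mu> g \<and> locally_negligible Y \<mu> {y \<in> topspace Y. f y \<noteq> g y}"

definition ess_integrable ::
    "'y topology \<Rightarrow> (('y \<Rightarrow> complex) \<Rightarrow> complex) \<Rightarrow> ('y \<Rightarrow> complex) \<Rightarrow> bool" where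
  "ess_integrable Y \<mu> f \<longleftrightarrow> (\<exists>g. ess_version Y \<mu> f g)"

definition ess_integral ::
    "'y topology \<Rightarrow> (('y \<Rightarrow> complex) \<Rightarrow> complex) \<Rightarrow> ('y \<Rightarrow> complex) \<Rightarrow> complex" where
  "ess_integral Y \<mu> f = (THE I. \<exists>g. ess_version Y \<mu> f g \<and> I = radon_integral Y \<mu> g)"

definition is_weak_integral ::
    "'y topology \<Rightarrow> 'a::complex_vector topology \<Rightarrow> (('y \<Rightarrow> complex) \<Rightarrow> complex) \<Rightarrow>
     ('y \<Rightarrow> 'a) \<Rightarrow> 'a \<Rightarrow> bool" where
  "is_weak_integral Y T \<mu> F I \<longleftrightarrow>
     I \<in> topspace T \<and> (\<forall>\<phi>\<in>dual_space T. \<phi> I = ess_integral Y \<mu> (\<phi> \<circ> F))"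

definition L1_space ::
    "'y topology \<Rightarrow> 'a::complex_vector topology \<Rightarrow> (('y \<Rightarrow> complex) \<Rightarrow> complex) \<Rightarrow>
     ('y \<Rightarrow> 'a) set" where
  "L1_space Y T \<mu> = {F.
     (\<forall>s\<in>topspace Y. F s \<in> topspace T) \<and> (\<forall>s. s \<notin> topspace Y \<longrightarrow> F s = 0) \<and>
     (\<forall>\<phi>\<in>dual_space T. ess_integrable Y \<mu> (\<phi> \<circ> F)) \<and>
     (\<exists>I. is_weak_integral Y T \<mu> F I)}"

definition weak_integral ::
    "'y topology \<Rightarrow> 'a::complex_vector topology \<Rightarrow> (('y \<Rightarrow> complex) \<Rightarrow> complex) \<Rightarrow>
     ('y \<Rightarrow> 'a) \<Rightarrow> 'a" where
  "weak_integral Y T \<mu> F = (THE I. is_weak_integral Y T \<mu> F I)"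

section \<open>Consistent classes of data\<close>

definition theta ::
    "'x set \<Rightarrow> ('x \<Rightarrow> 'v::complex_vector topology) \<Rightarrow> ('x \<Rightarrow> 'v \<Rightarrow> 'v) \<Rightarrow>
     ('x \<Rightarrow> 'v) \<Rightarrow> 'x \<Rightarrow> 'v" where
  "theta X E u = zero_ext (prod_space X (\<lambda>x. topspace (E x))) (\<lambda>f x. u x (f x))"

text \<open>
  \<open>E x\<close> is the topology of the space with index \<open>x\<close> and \<open>NE x\<close> its seminorms; \<open>\<tau> x\<close>, \<open>N\<tau> x\<close>
  are those of the space of continuous endomorphisms of \<open>E x\<close>; \<open>H\<close> is the topology whose carrier
  \<open>topspace H\<close> is the distinguished subspace of the product.
\<close>

locale consistent_data =
  fixes X :: "'x set"
    and Y :: "'y topology"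
    and \<mu> :: "('y \<Rightarrow> complex) \<Rightarrow> complex"
    and E :: "'x \<Rightarrow> 'v::complex_vector topology"
    and NE :: "'x \<Rightarrow> ('v \<Rightarrow> real) set"
    and \<tau> :: "'x \<Rightarrow> ('v \<Rightarrow> 'v) topology"
    and N\<tau> :: "'x \<Rightarrow> (('v \<Rightarrow> 'v) \<Rightarrow> real) set"
    and H :: "('x \<Rightarrow> 'v) topology"
    and A :: "('x \<Rightarrow> 'v \<Rightarrow> 'v) set"
  assumes locally_compact_Y: "locally_compact_space Y" "Hausdorff_space Y"
    and radon: "radon_measure Y \<mu>"
    and hlcs_E: "x \<in> X \<Longrightarrow> hlcs (E x)"
    and seminorms_E: "x \<in> X \<Longrightarrow> fundamental_seminorms (E x) (NE x)"
    and hlcs_\<tau>: "x \<in> X \<Longrightarrow> hlcs (\<tau> x)"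
    and topspace_\<tau>: "x \<in> X \<Longrightarrow> topspace (\<tau> x) = L_space (E x)"
    and seminorms_\<tau>: "x \<in> X \<Longrightarrow> fundamental_seminorms (\<tau> x) (N\<tau> x)"
    and hlcs_H: "hlcs H"
    and H_subset: "topspace H \<subseteq> prod_space X (\<lambda>x. topspace (E x))"
    and inj_H: "x \<in> X \<Longrightarrow> inj_coord x ` topspace (E x) \<subseteq> topspace H"
    and continuous_Proj: "x \<in> X \<Longrightarrow> continuous_map H (E x) (Proj x)"
    and continuous_inj: "x \<in> X \<Longrightarrow> continuous_map (E x) H (inj_coord x)"
    and subspace_A: "complex_vector.subspace A"
    and A_subset: "A \<subseteq> prod_space X (\<lambda>x. L_space (E x))"
    and theta_A: "u \<in> A \<Longrightarrow> zero_ext (topspace H) (theta X E u) \<in> L_space H"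
    and inj_A: "x \<in> X \<Longrightarrow> inj_coord x ` L_space (E x) \<subseteq> A"

definition G_carrier ::
    "'x set \<Rightarrow> ('x \<Rightarrow> 'v::complex_vector topology) \<Rightarrow> ('x \<Rightarrow> 'v) topology \<Rightarrow>
     ('x \<Rightarrow> 'v \<Rightarrow> 'v) set \<Rightarrow> (('x \<Rightarrow> 'v) \<Rightarrow> 'x \<Rightarrow> 'v) set" where
  "G_carrier X E H A = {zero_ext (topspace H) (theta X E u) | u. u \<in> A}"

definition h_map ::
    "('x \<Rightarrow> 'v::complex_vector) topology \<Rightarrow> 'x \<Rightarrow> ('v \<Rightarrow> 'v) \<Rightarrow> ('x \<Rightarrow> 'v) \<Rightarrow> 'x \<Rightarrow> 'v" where
  "h_map H x f = zero_ext (topspace H) (inj_coord x \<circ> f \<circ> Proj x)"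

definition G_topology ::
    "'x set \<Rightarrow> ('x \<Rightarrow> 'v::complex_vector topology) \<Rightarrow> ('x \<Rightarrow> ('v \<Rightarrow> 'v) topology) \<Rightarrow>
     ('x \<Rightarrow> 'v) topology \<Rightarrow> ('x \<Rightarrow> 'v \<Rightarrow> 'v) set \<Rightarrow> (('x \<Rightarrow> 'v) \<Rightarrow> 'x \<Rightarrow> 'v) topology" where
  "G_topology X E \<tau> H A = finest_lcs_topology (G_carrier X E H A) X \<tau> (h_map H)"

text \<open>
  For \<open>F s\<close> an endomorphism of \<open>topspace H\<close> extended by \<open>0\<close>, the composition below is automatically
  \<open>0\<close> outside \<open>topspace (E x)\<close>, and it vanishes for indices outside \<open>X\<close>.
\<close>

definition Psi ::
    "('y \<Rightarrow> ('x \<Rightarrow> 'v::complex_vector) \<Rightarrow> 'x \<Rightarrow> 'v) \<Rightarrow> 'x \<Rightarrow> 'y \<Rightarrow> 'v \<Rightarrow> 'v" where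
  "Psi F = (\<lambda>x s. Proj x \<circ> F s \<circ> inj_coord x)"

end

theory Submission
  imports Defs
begin

text \<open>
  For each \<open>x\<close> the compression \<open>g \<mapsto> Pr\<^sub>x \<circ> g \<circ> \<imath>\<^sub>x\<close> is a continuous linear map from \<open>\<GG>\<close> to
  \<open>\<tau> x\<close>: composed with \<open>h\<^sub>y\<close> it is the identity for \<open>y = x\<close> and \<open>0\<close> otherwise, and \<open>\<GG>\<close> carries the
  finest locally convex topology making the \<open>h\<^sub>y\<close> continuous. Continuous linear maps commute
  with weak integrals, which are unique as soon as the dual separates points. For \<open>\<tau> x\<close> this
  is the Hahn-Banach theorem; for \<open>\<GG>\<close> it follows because the compressions are jointly injective.
\<close>

section \<open>Sublinear functionals and the real Hahn-Banach theorem\<close>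

definition sublinear :: "('a::real_vector \<Rightarrow> real) \<Rightarrow> bool" where
  "sublinear q \<longleftrightarrow>
     (\<forall>v w. q (v + w) \<le> q v + q w) \<and> (\<forall>t v. 0 \<le> t \<longrightarrow> q (t *\<^sub>R v) = t * q v)"

lemma sublinearD:
  assumes "sublinear q"
  shows "q (v + w) \<le> q v + q w" and "0 \<le> t \<Longrightarrow> q (t *\<^sub>R v) = t * q v"
    and "q 0 = 0" and "- q (- v) \<le> q v"
proof -
  show add: "q (v + w) \<le> q v + q w" for v w
    using assms by (simp add: sublinear_def)
  show scale: "0 \<le> t \<Longrightarrow> q (t *\<^sub>R v) = t * q v" for t v
    using assms by (simp add: sublinear_def)
  show "q 0 = 0"
    using scale[of 0 0] by simp
  then show "- q (- v) \<le> q v"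
    using add[of v "- v"] by simp
qed

text \<open>
  The largest sublinear functional below \<open>q\<close> whose value at \<open>- a\<close> is at most \<open>- q a\<close>. A minimal
  sublinear functional is equal to all of its tilts and hence is additive, and a linear
  functional below \<open>tilt q a\<close> attains \<open>q a\<close> at \<open>a\<close>.
\<close>

definition tilt :: "('a::real_vector \<Rightarrow> real) \<Rightarrow> 'a \<Rightarrow> 'a \<Rightarrow> real" where
  "tilt q a v = (INF t\<in>{0..}. q (v + t *\<^sub>R a) - t * q a)"

text \<open>Subadditivity for t a = (v + t a) + (- v) bounds the terms of the infimum below by - q
  (- v), so the real \<open>INF\<close> in \<open>tilt\<close> is a genuine infimum.\<close>

lemma tilt_le:
  assumes q: "sublinear q" and "0 \<le> t"
  shows "tilt q a v \<le> q (v + t *\<^sub>R a) - t * q a"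
  unfolding tilt_def
proof (rule cINF_lower)
  show "bdd_below ((\<lambda>t. q (v + t *\<^sub>R a) - t * q a) ` {0..})"
  proof (rule bdd_belowI2)
    fix t :: real assume "t \<in> {0..}"
    then have "t * q a \<le> q (v + t *\<^sub>R a) + q (- v)"
      using sublinearD(1)[OF q, of "v + t *\<^sub>R a" "- v"] sublinearD(2)[OF q, of t a] by simp
    then show "- q (- v) \<le> q (v + t *\<^sub>R a) - t * q a"
      by simp
  qed
qed (use assms in auto)

lemma tilt_greatest:
  "(\<And>t. 0 \<le> t \<Longrightarrow> m \<le> q (v + t *\<^sub>R a) - t * q a) \<Longrightarrow> m \<le> tilt q a v"
  unfolding tilt_def by (rule cINF_greatest) auto

lemma tilt_le_self: "sublinear q \<Longrightarrow> tilt q a v \<le> q v"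
  using tilt_le[of q 0 a v] by simp

text \<open>Parameters add: the terms for t at v and for s at w together dominate the term for t + s
  at v + w. They also scale: t at v corresponds to r * t at r v.\<close>

lemma sublinear_tilt:
  assumes q: "sublinear q"
  shows "sublinear (tilt q a)"
  unfolding sublinear_def
proof (intro conjI allI impI)
  fix v w
  \<comment> \<open>The two infima on the right are taken one after the other: first over t with s
    fixed, then over s.\<close>
  have "tilt q a (v + w) - (q (w + s *\<^sub>R a) - s * q a) \<le> tilt q a v" if "0 \<le> s" for s
  proof (rule tilt_greatest)
    fix t :: real assume "0 \<le> t"
    have "q (v + w + (t + s) *\<^sub>R a) \<le> q (v + t *\<^sub>R a) + q (w + s *\<^sub>R a)"
      using sublinearD(1)[OF q, of "v + t *\<^sub>R a" "w + s *\<^sub>R a"] by (simp add: algebra_simps)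
    then show "tilt q a (v + w) - (q (w + s *\<^sub>R a) - s * q a) \<le> q (v + t *\<^sub>R a) - t * q a"
      using tilt_le[OF q, of "t + s" a "v + w"] \<open>0 \<le> t\<close> \<open>0 \<le> s\<close> by (simp add: algebra_simps)
  qed
  then have "tilt q a (v + w) - tilt q a v \<le> tilt q a w"
    by (intro tilt_greatest) (simp add: algebra_simps)
  then show "tilt q a (v + w) \<le> tilt q a v + tilt q a w"
    by simp
next
  have zero: "tilt q a 0 = 0"
  proof (rule antisym)
    show "tilt q a 0 \<le> 0"
      using tilt_le_self[OF q, of a 0] sublinearD(3)[OF q] by simp
    show "0 \<le> tilt q a 0"
      by (rule tilt_greatest) (simp add: sublinearD(2)[OF q])
  qed
  have le: "tilt q a (r *\<^sub>R v) \<le> r * tilt q a v" if "0 < r" for r v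
  proof -
    have "tilt q a (r *\<^sub>R v) / r \<le> tilt q a v"
    proof (rule tilt_greatest)
      fix t :: real assume "0 \<le> t"
      then have "tilt q a (r *\<^sub>R v) \<le> q (r *\<^sub>R v + (r * t) *\<^sub>R a) - (r * t) * q a"
        using tilt_le[OF q, of "r * t" a "r *\<^sub>R v"] that by simp
      also have "\<dots> = r * (q (v + t *\<^sub>R a) - t * q a)"
        using sublinearD(2)[OF q, of r "v + t *\<^sub>R a"] that by (simp add: algebra_simps)
      finally show "tilt q a (r *\<^sub>R v) / r \<le> q (v + t *\<^sub>R a) - t * q a"
        using that by (simp add: field_simps)
    qed
    then show ?thesis
      using that by (simp add: field_simps)
  qed
  fix r :: real and v assume "0 \<le> r"
  show "tilt q a (r *\<^sub>R v) = r * tilt q a v"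
  proof (cases "r = 0")
    case True
    then show ?thesis by (simp add: zero)
  next
    case False
    then have "0 < r" using \<open>0 \<le> r\<close> by simp
    \<comment> \<open>The reverse inequality is \<open>le\<close> for the factor 1 / r at the vector
      r v.\<close>
    moreover have "tilt q a v \<le> tilt q a (r *\<^sub>R v) / r"
      using le[of "1 / r" "r *\<^sub>R v"] \<open>0 < r\<close> by simp
    ultimately show ?thesis
      using le[of r v] by (simp add: field_simps)
  qed
qed

lemma linear_if_minimal_sublinear:
  assumes q: "sublinear q"
    and minimal: "\<And>r. sublinear r \<Longrightarrow> r \<le> q \<Longrightarrow> r = q"
  shows "linear q"
proof -
  have tilt: "tilt q a = q" for a
    by (rule minimal[OF sublinear_tilt[OF q]]) (simp add: le_fun_def tilt_le_self[OF q])
  \<comment> \<open>The parameter 1 in the tilt along w yields q v \<le> q (v + w) - q w, the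
    converse of subadditivity.\<close>
  have add: "q (v + w) = q v + q w" for v w
    using tilt_le[OF q, of 1 w v] sublinearD(1)[OF q, of v w] by (simp add: tilt)
  have neg: "q (- v) = - q v" for v
    using add[of v "- v"] sublinearD(3)[OF q] by simp
  have "q (t *\<^sub>R v) = t * q v" for t v
  proof (cases "0 \<le> t")
    case False
    then show ?thesis
      using sublinearD(2)[OF q, of "- t" v] by (simp add: neg)
  qed (simp add: sublinearD(2)[OF q])
  then show ?thesis
    by (intro linearI) (simp_all add: add)
qed

text \<open>Provides the lower bounds of chains for Zorn's lemma. The infimum is finite because
  every member of the chain stays above - p (- v).\<close>

lemma sublinear_INF_chain:
  assumes ne: "C \<noteq> {}" and sub: "\<And>q. q \<in> C \<Longrightarrow> sublinear q \<and> q \<le> p"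
    and chain: "\<And>q r. q \<in> C \<Longrightarrow> r \<in> C \<Longrightarrow> q \<le> r \<or> r \<le> q"
  shows "sublinear (\<lambda>v. INF q\<in>C. q v)" and "\<And>q v. q \<in> C \<Longrightarrow> (INF r\<in>C. r v) \<le> q v"
proof -
  let ?m = "\<lambda>v. INF q\<in>C. q v"
  have bdd: "bdd_below ((\<lambda>q. q v) ` C)" for v
  proof (rule bdd_belowI2)
    fix q assume "q \<in> C"
    then have "- q (- v) \<le> q v" "q (- v) \<le> p (- v)"
      using sub sublinearD(4) by (auto simp: le_fun_def)
    then show "- p (- v) \<le> q v" by simp
  qed
  show lower: "?m v \<le> q v" if "q \<in> C" for q v
    by (rule cINF_lower[OF bdd that])
  have greatest: "c \<le> ?m v" if "\<And>q. q \<in> C \<Longrightarrow> c \<le> q v" for c v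
    by (rule cINF_greatest[OF ne that])
  show "sublinear ?m"
    unfolding sublinear_def
  proof (intro conjI allI impI)
    fix v w
    have "?m (v + w) \<le> q v + r w" if "q \<in> C" "r \<in> C" for q r
    proof -
      \<comment> \<open>Of two members of a chain the smaller one serves both vectors, so its own
        subadditivity can be used.\<close>
      obtain s where "s \<in> C" "s \<le> q" "s \<le> r"
        using chain[of q r] \<open>q \<in> C\<close> \<open>r \<in> C\<close> by blast
      then have "?m (v + w) \<le> s v + s w"
        using lower[of s "v + w"] sub sublinearD(1)[of s v w] by fastforce
      then show ?thesis
        using \<open>s \<le> q\<close> \<open>s \<le> r\<close> by (smt (verit) le_fun_def)
    qed
    then have "?m (v + w) - r w \<le> ?m v" if "r \<in> C" for r
      using that by (intro greatest) (simp add: algebra_simps)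
    then have "?m (v + w) - ?m v \<le> ?m w"
      by (intro greatest) (simp add: algebra_simps)
    then show "?m (v + w) \<le> ?m v + ?m w" by simp
  next
    fix t :: real and v assume t: "0 \<le> t"
    show "?m (t *\<^sub>R v) = t * ?m v"
    proof (cases "t = 0")
      case True
      have "(INF q\<in>C. q 0) = (INF q\<in>C. 0)"
        using sub sublinearD(3) by (intro INF_cong) auto
      then show ?thesis using True ne by simp
    next
      case False
      then have "0 < t" using t by simp
      have "?m (t *\<^sub>R v) / t \<le> ?m v"
      proof (rule greatest)
        fix q assume "q \<in> C"
        then show "?m (t *\<^sub>R v) / t \<le> q v"
          using lower[of q "t *\<^sub>R v"] sub sublinearD(2)[of q t v] \<open>0 < t\<close>
          by (simp add: field_simps)
      qed
      moreover have "t * ?m v \<le> ?m (t *\<^sub>R v)"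
      proof (rule greatest)
        fix q assume "q \<in> C"
        then show "t * ?m v \<le> q (t *\<^sub>R v)"
          using lower[of q v] sub sublinearD(2)[of q t v] \<open>0 < t\<close> by simp
      qed
      ultimately show ?thesis
        using \<open>0 < t\<close> by (simp add: field_simps)
    qed
  qed
qed

text \<open>Zorn's lemma yields a minimal sublinear functional below p, and minimality forces
  linearity. The order is reversed in \<open>relation_of\<close>, so that a maximal element is a
  minimal functional.\<close>

theorem linear_below_sublinear:
  assumes p: "sublinear p"
  obtains f where "linear f" "f \<le> p"
proof -
  let ?S = "{q. sublinear q \<and> q \<le> p}"
  have "\<exists>m\<in>?S. \<forall>q\<in>?S. q \<le> m \<longrightarrow> q = m"
  proof (rule predicate_Zorn)
    show "partial_order_on ?S (relation_of (\<lambda>q r. r \<le> q) ?S)"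
      by (rule partial_order_on_relation_ofI) auto
    fix C assume C: "C \<in> Chains (relation_of (\<lambda>q r. r \<le> q) ?S)"
    show "\<exists>u\<in>?S. \<forall>a\<in>C. u \<le> a"
    proof (cases "C = {}")
      case True
      then show ?thesis using p by auto
    next
      case False
      have sub: "\<And>q. q \<in> C \<Longrightarrow> sublinear q \<and> q \<le> p"
        and chain: "\<And>q r. q \<in> C \<Longrightarrow> r \<in> C \<Longrightarrow> q \<le> r \<or> r \<le> q"
        using C by (auto simp: Chains_def relation_of_def)
      have "sublinear (\<lambda>v. INF q\<in>C. q v)"
        using sublinear_INF_chain(1)[of C p] False sub chain by blast
      moreover have "(\<lambda>v. INF q\<in>C. q v) \<le> q" if "q \<in> C" for q
        using sublinear_INF_chain(2)[of C p q] False sub chain that by (auto simp: le_fun_def)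
      ultimately show ?thesis
        using False sub by (intro bexI[of _ "\<lambda>v. INF q\<in>C. q v"]) (auto intro: order_trans)
    qed
  qed
  then obtain m where m: "sublinear m" "m \<le> p"
    and "\<And>q. sublinear q \<Longrightarrow> q \<le> p \<Longrightarrow> q \<le> m \<Longrightarrow> q = m" by blast
  \<comment> \<open>Whatever lies below m lies below p, so m is minimal among all sublinear
    functionals and not only in \<open>?S\<close>.\<close>
  then have "linear m"
    by (intro linear_if_minimal_sublinear) (auto intro: order_trans)
  then show ?thesis using m that by blast
qed

theorem Hahn_Banach_sublinear:
  assumes p: "sublinear p"
  obtains f where "linear f" "f \<le> p" "f a = p a"
proof -
  obtain f where f: "linear f" "f \<le> tilt p a"
    using linear_below_sublinear[OF sublinear_tilt[OF p]] by blast
  have "f \<le> p"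
    using f(2) tilt_le_self[OF p] by (meson le_fun_def order_trans)
  \<comment> \<open>The term of the tilt with parameter 1 at - a is p 0 - p a, and p 0 = 0.\<close>
  moreover have "f (- a) \<le> - p a"
    using f(2) tilt_le[OF p, of 1 a "- a"] sublinearD(3)[OF p]
    by (auto simp: le_fun_def intro: order_trans)
  then have "p a \<le> f a"
    by (simp add: linear_neg[OF f(1)])
  ultimately show ?thesis
    using that f(1) by (meson antisym le_funD)
qed

section \<open>Complex functionals bounded by a seminorm, and separation of points by the
  dual\<close>

lemma subspace_if_complex_subspace:
  "complex_vector.subspace S \<Longrightarrow> subspace S"
  by (simp add: complex_vector.subspace_def subspace_def scaleR_scaleC)

text \<open>The real theorem supplies the real part of \<phi>. The factor 2 comes from bounding real
  and imaginary part separately; any constant is good enough for continuity.\<close>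

theorem Hahn_Banach_seminorm:
  fixes p :: "'a::complex_vector \<Rightarrow> real"
  assumes S: "complex_vector.subspace S" and p: "seminorm_on S p" and a: "a \<in> S"
  obtains \<phi> where "clinear_on S \<phi>" "\<And>v. v \<in> S \<Longrightarrow> cmod (\<phi> v) \<le> 2 * p v" "Re (\<phi> a) = p a"
proof -
  have sub: "\<And>v w. v \<in> S \<Longrightarrow> w \<in> S \<Longrightarrow> v + w \<in> S" "\<And>c v. v \<in> S \<Longrightarrow> c *\<^sub>C v \<in> S"
    using S by (auto simp: complex_vector.subspace_def)
  have p_add: "p (v + w) \<le> p v + p w" if "v \<in> S" "w \<in> S" for v w
    using p that by (simp add: seminorm_on_def)
  have p_scale: "p (c *\<^sub>C v) = cmod c * p v" if "v \<in> S" for c v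
    using p that by (simp add: seminorm_on_def)
  \<comment> \<open>The seminorm is controlled only on S, while \<open>sublinear\<close> speaks of
    the whole type. A real-linear projection onto S bridges the two.\<close>
  obtain \<pi> :: "'a \<Rightarrow> 'a" where \<pi>: "range \<pi> \<subseteq> S" "linear \<pi>" "\<And>v. v \<in> S \<Longrightarrow> \<pi> v = v"
    using linear_exists_left_inverse_on[OF linear_id subspace_if_complex_subspace[OF S]] by auto
  have \<pi>S: "\<pi> v \<in> S" for v
    using \<pi>(1) by auto
  have "sublinear (\<lambda>v. p (\<pi> v))"
    unfolding sublinear_def linear_add[OF \<pi>(2)] linear_scale[OF \<pi>(2)]
    by (simp add: scaleR_scaleC p_add p_scale \<pi>S)
  then obtain f where f: "linear f" "f \<le> (\<lambda>v. p (\<pi> v))" "f a = p (\<pi> a)"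
    using Hahn_Banach_sublinear by blast
  have f_le: "\<bar>f v\<bar> \<le> p v" if "v \<in> S" for v
  proof -
    have "- v = (- 1) *\<^sub>C v"
      by simp
    then have "- v \<in> S" "p (- v) = p v"
      using sub(2)[OF that, of "- 1"] p_scale[OF that, of "- 1"] by simp_all
    then show ?thesis
      using le_funD[OF f(2), of v] le_funD[OF f(2), of "- v"] \<pi>(3) that linear_neg[OF f(1), of v]
      by simp
  qed
  \<comment> \<open>Complex linearity forces the imaginary part at v to be minus the real part at
    \<i> v.\<close>
  define \<phi> where "\<phi> v = Complex (f v) (- f (\<i> *\<^sub>C v))" for v
  have scaleC: "c *\<^sub>C v = Re c *\<^sub>R v + Im c *\<^sub>R (\<i> *\<^sub>C v)" for c and v :: 'a
    by (simp add: scaleR_scaleC scaleC_scaleC flip: scaleC_add_left)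
      (simp add: complex_eq mult.commute)
  have f_scale: "f (c *\<^sub>C v) = Re c * f v + Im c * f (\<i> *\<^sub>C v)" for c v
    by (subst scaleC) (simp add: linear_add[OF f(1)] linear_scale[OF f(1)])
  have "clinear_on S \<phi>"
    unfolding clinear_on_def
  proof (intro conjI ballI allI)
    fix v w
    show "\<phi> (v + w) = \<phi> v + \<phi> w"
      by (simp add: \<phi>_def scaleC_add_right linear_add[OF f(1)] complex_eq_iff)
  next
    fix c v
    have "f (\<i> *\<^sub>C c *\<^sub>C v) = Re c * f (\<i> *\<^sub>C v) - Im c * f v"
      using f_scale[of "\<i> * c" v] by (simp add: scaleC_scaleC)
    then show "\<phi> (c *\<^sub>C v) = c *\<^sub>C \<phi> v"
      by (simp add: \<phi>_def f_scale[of c v] scaleC_complex_def complex_eq_iff)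
  qed
  moreover have "cmod (\<phi> v) \<le> 2 * p v" if "v \<in> S" for v
  proof -
    have "cmod (\<phi> v) \<le> \<bar>f v\<bar> + \<bar>f (\<i> *\<^sub>C v)\<bar>"
      using cmod_le[of "\<phi> v"] by (simp add: \<phi>_def)
    then show ?thesis
      using f_le[OF that] f_le[OF sub(2)[OF that], of \<i>] p_scale[OF that, of \<i>] by simp
  qed
  moreover have "Re (\<phi> a) = p a"
    using f(3) \<pi>(3)[OF a] by (simp add: \<phi>_def)
  ultimately show ?thesis
    using that by blast
qed

lemma lcs_subspace: "lcs T \<Longrightarrow> complex_vector.subspace (topspace T)"
  by (simp add: lcs_def)

lemma clinear_on_diff:
  assumes "complex_vector.subspace S" "clinear_on S f" "v \<in> S" "w \<in> S"
  shows "f (v - w) = f v - f w"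
proof -
  have "(- 1) *\<^sub>C w \<in> S"
    using assms complex_vector.subspace_scale by blast
  then have "f (v + (- 1) *\<^sub>C w) = f v + (- 1) *\<^sub>C f w"
    using assms unfolding clinear_on_def by metis
  then show ?thesis by simp
qed

lemma clinear_on_zero:
  assumes "complex_vector.subspace S" "clinear_on S f"
  shows "f 0 = 0"
  using clinear_on_diff[OF assms, of 0 0] complex_vector.subspace_0[OF assms(1)] by simp

lemma continuous_map_if_seminorm_bounded:
  assumes T: "lcs T" and N: "fundamental_seminorms T N" and p: "p \<in> N"
    and \<phi>: "clinear_on (topspace T) \<phi>"
    and bound: "\<And>v. v \<in> topspace T \<Longrightarrow> cmod (\<phi> v) \<le> C * p v"
  shows "continuous_map T euclidean \<phi>"
  unfolding continuous_map_def
proof (intro conjI allI impI)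
  note S = lcs_subspace[OF T]
  fix U :: "complex set" assume "openin euclidean U"
  then have U: "open U" by simp
  have nonneg: "0 \<le> p v" if "v \<in> topspace T" for v
    using N p that by (auto simp: fundamental_seminorms_def seminorm_on_def)
  have "\<exists>P e. finite P \<and> P \<subseteq> N \<and> 0 < e \<and>
      {w \<in> topspace T. \<forall>p\<in>P. p (w - v) < e} \<subseteq> {v \<in> topspace T. \<phi> v \<in> U}"
    if v: "v \<in> topspace T" "\<phi> v \<in> U" for v
  proof -
    obtain e where e: "0 < e" "ball (\<phi> v) e \<subseteq> U"
      using U v(2) open_contains_ball by blast
    \<comment> \<open>Adding 1 to the absolute value of C keeps the denominator positive even for C
      = 0.\<close>
    let ?d = "e / (\<bar>C\<bar> + 1)"
    have "\<phi> w \<in> U" if w: "w \<in> topspace T" "p (w - v) < ?d" for w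
    proof -
      have wv: "w - v \<in> topspace T"
        using complex_vector.subspace_diff[OF S] w v by blast
      have "cmod (\<phi> w - \<phi> v) \<le> C * p (w - v)"
        using bound[OF wv] clinear_on_diff[OF S \<phi> w(1) v(1)] by simp
      also have "\<dots> \<le> (\<bar>C\<bar> + 1) * p (w - v)"
        using nonneg[OF wv] by (intro mult_right_mono) auto
      also have "\<dots> < e"
        using w(2) by (simp add: field_simps)
      finally show ?thesis
        using e(2) by (auto simp: dist_norm norm_minus_commute)
    qed
    then show ?thesis
      using e(1) p by (intro exI[of _ "{p}"] exI[of _ ?d]) auto
  qed
  then show "openin T {v \<in> topspace T. \<phi> v \<in> U}"
    using N unfolding fundamental_seminorms_def by auto
qed simp

text \<open>A neighbourhood of v that misses w contains a ball for finitely many seminorms, so one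
  of them is bounded away from 0 at w - v. Hahn-Banach for this seminorm gives a continuous
  functional that is nonzero at w - v.\<close>

lemma dual_space_separates:
  assumes T: "hlcs T" and N: "fundamental_seminorms T N"
    and v: "v \<in> topspace T" and w: "w \<in> topspace T"
    and eq: "\<And>\<phi>. \<phi> \<in> dual_space T \<Longrightarrow> \<phi> v = \<phi> w"
  shows "v = w"
proof (rule ccontr)
  assume "v \<noteq> w"
  have lcs: "lcs T" and haus: "Hausdorff_space T"
    using T by (auto simp: hlcs_def)
  note S = lcs_subspace[OF lcs]
  obtain U where U: "openin T U" "v \<in> U" "w \<notin> U"
    using haus v w \<open>v \<noteq> w\<close> unfolding Hausdorff_space_def disjnt_iff by metis
  then obtain P e where P: "P \<subseteq> N" "0 < e" "{u \<in> topspace T. \<forall>p\<in>P. p (u - v) < e} \<subseteq> U"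
    using N unfolding fundamental_seminorms_def by blast
  then obtain p where p: "p \<in> N" "e \<le> p (w - v)"
    using U(3) w by force
  have wv: "w - v \<in> topspace T"
    using complex_vector.subspace_diff[OF S] w v by blast
  have "seminorm_on (topspace T) p"
    using N p(1) by (simp add: fundamental_seminorms_def)
  then obtain \<phi> where \<phi>: "clinear_on (topspace T) \<phi>"
      "\<And>v. v \<in> topspace T \<Longrightarrow> cmod (\<phi> v) \<le> 2 * p v" "Re (\<phi> (w - v)) = p (w - v)"
    using Hahn_Banach_seminorm[OF S _ wv] by blast
  have "continuous_map T euclidean \<phi>"
    by (rule continuous_map_if_seminorm_bounded[OF lcs N p(1) \<phi>(1,2)])
  \<comment> \<open>Members of \<open>dual_space\<close> must be 0 off the carrier, which \<phi>
    itself need not be.\<close>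
  then have "continuous_map T euclidean (zero_ext (topspace T) \<phi>)"
    by (rule continuous_map_eq) (simp add: zero_ext_def)
  moreover have "clinear_on (topspace T) (zero_ext (topspace T) \<phi>)"
    using \<phi>(1) complex_vector.subspace_add[OF S] complex_vector.subspace_scale[OF S]
    by (simp add: clinear_on_def zero_ext_def)
  ultimately have "zero_ext (topspace T) \<phi> \<in> dual_space T"
    by (simp add: dual_space_def zero_ext_def)
  from eq[OF this] have "\<phi> v = \<phi> w"
    using v w by (simp add: zero_ext_def)
  then have "\<phi> (w - v) = 0"
    using clinear_on_diff[OF S \<phi>(1) w v] by simp
  then show False
    using \<phi>(3) p(2) \<open>0 < e\<close> by simp
qed

section \<open>Pullback topologies and the universal property of the finest locally convex
  topology\<close>

text \<open>A linear f intertwines the vector operations, so their continuity transfers from T;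
  preimages of convex neighbourhoods of 0 are again convex neighbourhoods of 0.\<close>

lemma lcs_pullback_topology:
  assumes S: "complex_vector.subspace S" and T: "lcs T"
    and f: "clinear_on S f" "f ` S \<subseteq> topspace T"
  shows "lcs (pullback_topology S f T)" and "topspace (pullback_topology S f T) = S"
proof -
  let ?P = "pullback_topology S f T"
  show ts: "topspace ?P = S"
    using f(2) by (auto simp: topspace_pullback_topology)
  have f_cont: "continuous_map ?P T f"
    using continuous_map_pullback[OF continuous_map_id, of S f T] by simp
  have sub: "0 \<in> S" "\<And>v w. v \<in> S \<Longrightarrow> w \<in> S \<Longrightarrow> v + w \<in> S" "\<And>c v. v \<in> S \<Longrightarrow> c *\<^sub>C v \<in> S"
    using S by (auto simp: complex_vector.subspace_def)
  have lin: "\<And>v w. v \<in> S \<Longrightarrow> w \<in> S \<Longrightarrow> f (v + w) = f v + f w"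
    "\<And>c v. v \<in> S \<Longrightarrow> f (c *\<^sub>C v) = c *\<^sub>C f v"
    using f(1) by (auto simp: clinear_on_def)
  have "continuous_map (prod_topology ?P ?P) ?P (\<lambda>(v, w). v + w)"
  proof (rule continuous_map_pullback')
    have "continuous_map (prod_topology ?P ?P) (prod_topology T T) (\<lambda>(v, w). (f v, f w))"
      by (rule continuous_map_prod_top[THEN iffD2]) (simp add: f_cont)
    moreover have "continuous_map (prod_topology T T) T (\<lambda>(v, w). v + w)"
      using T by (simp add: lcs_def)
    ultimately have "continuous_map (prod_topology ?P ?P) T
        ((\<lambda>(v, w). v + w) \<circ> (\<lambda>(v, w). (f v, f w)))"
      by (rule continuous_map_compose)
    then show "continuous_map (prod_topology ?P ?P) T (f \<circ> (\<lambda>(v, w). v + w))"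
      by (rule continuous_map_eq) (auto simp: ts lin)
  qed (auto simp: ts sub)
  moreover have "continuous_map (prod_topology euclidean ?P) ?P (\<lambda>(c, v). c *\<^sub>C v)"
  proof (rule continuous_map_pullback')
    have "continuous_map (prod_topology euclidean ?P) (prod_topology euclidean T)
        (\<lambda>(c, v). (id c :: complex, f v))"
      by (rule continuous_map_prod_top[THEN iffD2]) (simp add: f_cont)
    moreover have "continuous_map (prod_topology euclidean T) T (\<lambda>(c, v). c *\<^sub>C v)"
      using T by (simp add: lcs_def)
    ultimately have "continuous_map (prod_topology euclidean ?P) T
        ((\<lambda>(c, v). c *\<^sub>C v) \<circ> (\<lambda>(c, v). (id c, f v)))"
      by (rule continuous_map_compose)
    then show "continuous_map (prod_topology euclidean ?P) T (f \<circ> (\<lambda>(c, v). c *\<^sub>C v))"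
      by (rule continuous_map_eq) (auto simp: ts lin)
  qed (auto simp: ts sub)
  moreover have "\<exists>V. openin ?P V \<and> convex V \<and> 0 \<in> V \<and> V \<subseteq> U" if U: "openin ?P U" "0 \<in> U" for U
  proof -
    obtain W where W: "openin T W" "U = f -` W \<inter> S"
      using U(1) by (auto simp: openin_pullback_topology)
    have f0: "f 0 = 0"
      by (rule clinear_on_zero[OF S f(1)])
    then obtain V where V: "openin T V" "convex V" "0 \<in> V" "V \<subseteq> W"
      using T W U(2) unfolding lcs_def by auto
    have "convex (f -` V \<inter> S)"
      using V(2) by (auto simp: convex_def scaleR_scaleC lin sub)
    then show ?thesis
      using V W sub(1) f0 by (intro exI[of _ "f -` V \<inter> S"]) (auto simp: openin_pullback_topology)
  qed
  ultimately show "lcs ?P"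
    using S by (simp add: lcs_def ts)
qed

text \<open>Continuity of the maps \<open>f \<circ> h i\<close> makes every \<open>h i\<close>
  continuous into the pullback of Z along f. The pullback is thus one of the topologies whose
  supremum is taken, and f is continuous already for it.\<close>

lemma continuous_map_finest_lcs_topology:
  assumes S: "complex_vector.subspace S" and Z: "lcs Z"
    and f: "clinear_on S f" "f ` S \<subseteq> topspace Z"
    and h: "\<And>i. i \<in> I \<Longrightarrow> h i \<in> topspace (T i) \<rightarrow> S"
    and fh: "\<And>i. i \<in> I \<Longrightarrow> continuous_map (T i) Z (f \<circ> h i)"
  shows "continuous_map (finest_lcs_topology S I T h) Z f"
proof -
  let ?P = "pullback_topology S f Z"
  let ?F = "finest_lcs_topology S I T h"
  note P = lcs_pullback_topology[OF S Z f]
  have "continuous_map (T i) ?P (h i)" if "i \<in> I" for i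
    by (rule continuous_map_pullback'[OF fh[OF that]]) (use h[OF that] in auto)
  then have mem: "?P \<in> lcs_topologies_for S I T h"
    using P by (simp add: lcs_topologies_for_def)
  have ts: "topspace ?F = S"
    using lcs_finest_lcs_topology[of S I h T, OF S h] by (simp add: lcs_topologies_for_def)
  show ?thesis
    unfolding continuous_map_def ts
  proof (intro conjI allI impI)
    fix U assume "openin Z U"
    then have "openin ?P (f -` U \<inter> S)"
      by (auto simp: openin_pullback_topology)
    moreover have "f -` U \<inter> S = {v \<in> S. f v \<in> U}"
      by auto
    ultimately show "openin ?F {v \<in> S. f v \<in> U}"
      using finest_lcs_topology_finest[OF mem] by simp
  qed (use f(2) in auto)
qed

section \<open>Weak integrals under continuous linear maps\<close>

lemma dual_space_compose:
  assumes S: "complex_vector.subspace (topspace S)"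
    and f: "clinear_on (topspace S) f" "continuous_map S T f"
    and \<phi>: "\<phi> \<in> dual_space T"
  shows "zero_ext (topspace S) (\<phi> \<circ> f) \<in> dual_space S"
proof -
  have fS: "f v \<in> topspace T" if "v \<in> topspace S" for v
    using continuous_map_image_subset_topspace[OF f(2)] that by blast
  have "continuous_map S euclidean (\<phi> \<circ> f)"
    using \<phi> f(2) by (auto simp: dual_space_def intro: continuous_map_compose)
  then have "continuous_map S euclidean (zero_ext (topspace S) (\<phi> \<circ> f))"
    by (rule continuous_map_eq) (simp add: zero_ext_def)
  moreover have "clinear_on (topspace S) (zero_ext (topspace S) (\<phi> \<circ> f))"
    using \<phi> f(1) fS complex_vector.subspace_add[OF S] complex_vector.subspace_scale[OF S]
    by (simp add: clinear_on_def zero_ext_def dual_space_def)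
  ultimately show ?thesis
    by (simp add: dual_space_def zero_ext_def)
qed

text \<open>Testing \<open>f \<circ> F\<close> against \<phi> is the same as testing F against the
  transposed functional, which belongs to the dual of S.\<close>

lemma L1_space_compose:
  assumes S: "complex_vector.subspace (topspace S)"
    and f: "clinear_on (topspace S) f" "continuous_map S T f"
    and F: "F \<in> L1_space Y S \<mu>"
  shows "is_weak_integral Y S \<mu> F I \<Longrightarrow> is_weak_integral Y T \<mu> (f \<circ> F) (f I)"
    and "f \<circ> F \<in> L1_space Y T \<mu>"
proof -
  have fS: "f v \<in> topspace T" if "v \<in> topspace S" for v
    using continuous_map_image_subset_topspace[OF f(2)] that by blast
  \<comment> \<open>Off Y the value is 0, which lies in the subspace; hence \<open>comp\<close> is
    an equality of total functions.\<close>
  have FS: "F s \<in> topspace S" for s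
    using F complex_vector.subspace_0[OF S] by (cases "s \<in> topspace Y") (auto simp: L1_space_def)
  have comp: "\<phi> \<circ> (f \<circ> F) = zero_ext (topspace S) (\<phi> \<circ> f) \<circ> F" for \<phi>
    by (simp add: fun_eq_iff zero_ext_def FS)
  show wi: "is_weak_integral Y T \<mu> (f \<circ> F) (f I)" if I: "is_weak_integral Y S \<mu> F I" for I
    unfolding is_weak_integral_def
  proof (intro conjI ballI)
    have IS: "I \<in> topspace S"
      using I by (simp add: is_weak_integral_def)
    then show "f I \<in> topspace T" by (rule fS)
    fix \<phi> assume "\<phi> \<in> dual_space T"
    then have "zero_ext (topspace S) (\<phi> \<circ> f) I =
        ess_integral Y \<mu> (zero_ext (topspace S) (\<phi> \<circ> f) \<circ> F)"
      using I dual_space_compose[OF S f] by (simp add: is_weak_integral_def)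
    then show "\<phi> (f I) = ess_integral Y \<mu> (\<phi> \<circ> (f \<circ> F))"
      unfolding comp using IS by (simp add: zero_ext_def)
  qed
  obtain I where "is_weak_integral Y S \<mu> F I"
    using F by (auto simp: L1_space_def)
  then have "\<exists>I. is_weak_integral Y T \<mu> (f \<circ> F) I"
    using wi by blast
  moreover have "ess_integrable Y \<mu> (\<phi> \<circ> (f \<circ> F))" if "\<phi> \<in> dual_space T" for \<phi>
    unfolding comp using F dual_space_compose[OF S f that] by (simp add: L1_space_def)
  \<comment> \<open>This keeps \<open>f \<circ> F\<close> equal to 0 off Y, as
    \<open>L1_space\<close> demands.\<close>
  moreover have "f 0 = 0"
    by (rule clinear_on_zero[OF S f(1)])
  ultimately show "f \<circ> F \<in> L1_space Y T \<mu>"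
    using F by (simp add: L1_space_def fS)
qed

text \<open>Separation of points gives the uniqueness on which the \<open>THE\<close> in
  \<open>weak_integral\<close> depends.\<close>

lemma weak_integral_eqI:
  assumes I: "is_weak_integral Y T \<mu> F I"
    and sep: "\<And>v w. v \<in> topspace T \<Longrightarrow> w \<in> topspace T \<Longrightarrow>
      (\<And>\<phi>. \<phi> \<in> dual_space T \<Longrightarrow> \<phi> v = \<phi> w) \<Longrightarrow> v = w"
  shows "weak_integral Y T \<mu> F = I"
  unfolding weak_integral_def
proof (rule the_equality[where P = "is_weak_integral Y T \<mu> F", OF I])
  fix J assume "is_weak_integral Y T \<mu> F J"
  then show "J = I"
    using I by (intro sep) (auto simp: is_weak_integral_def)
qed

section \<open>Coordinate blocks and the space \<open>G\<close>\<close>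

text \<open>With g read as a block matrix, this is its diagonal entry at x.\<close>

definition coord_block :: "'x \<Rightarrow> (('x \<Rightarrow> 'v::zero) \<Rightarrow> 'x \<Rightarrow> 'v) \<Rightarrow> 'v \<Rightarrow> 'v" where
  "coord_block x g = Proj x \<circ> g \<circ> inj_coord x"

lemma Psi_eq_coord_block: "Psi F x = coord_block x \<circ> F"
  by (simp add: Psi_def coord_block_def fun_eq_iff)

text \<open>Linearity is meant in the operator, for the pointwise structure on functions, and not in
  the vector it acts on.\<close>

lemma clinear_on_coord_block: "clinear_on S (coord_block x)"
  by (simp add: clinear_on_def coord_block_def Proj_def fun_eq_iff scaleC_fun_def)

lemma clinear_on_Psi: "clinear_on S Psi"
  by (simp add: clinear_on_def Psi_def Proj_def fun_eq_iff scaleC_fun_def)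

context consistent_data
begin

abbreviation "G \<equiv> G_carrier X E H A"
abbreviation "G_top \<equiv> G_topology X E \<tau> H A"

text \<open>The carrier of H lies in the product, so the cut-off inside \<open>theta\<close> is
  invisible there.\<close>

lemma theta_apply:
  "f \<in> topspace H \<Longrightarrow> theta X E u f = (\<lambda>x. u x (f x))"
  using H_subset by (auto simp: theta_def zero_ext_def)

lemma G_carrierE:
  assumes "g \<in> G"
  obtains u where "u \<in> A" "g = zero_ext (topspace H) (\<lambda>f x. u x (f x))"
proof -
  obtain u where u: "u \<in> A" "g = zero_ext (topspace H) (theta X E u)"
    using assms by (auto simp: G_carrier_def)
  moreover have "g = zero_ext (topspace H) (\<lambda>f x. u x (f x))"
    unfolding u(2) by (rule ext) (simp add: zero_ext_def theta_apply)
  ultimately show ?thesis using that by blast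
qed

lemma G_carrierI:
  assumes "u \<in> A"
  shows "zero_ext (topspace H) (\<lambda>f x. u x (f x)) \<in> G"
proof -
  have "zero_ext (topspace H) (\<lambda>f x. u x (f x)) = zero_ext (topspace H) (theta X E u)"
    by (rule ext) (simp add: zero_ext_def theta_apply)
  then show ?thesis
    using assms by (auto simp: G_carrier_def)
qed

lemma subspace_G: "complex_vector.subspace G"
  unfolding complex_vector.subspace_def
proof (intro conjI ballI allI)
  have "zero_ext (topspace H) (\<lambda>f x. (0 :: 'x \<Rightarrow> 'v \<Rightarrow> 'v) x (f x)) \<in> G"
    using complex_vector.subspace_0[OF subspace_A] by (rule G_carrierI)
  moreover have "zero_ext (topspace H) (\<lambda>f x. (0 :: 'x \<Rightarrow> 'v \<Rightarrow> 'v) x (f x)) = 0"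
    by (simp add: zero_ext_def fun_eq_iff)
  ultimately show "0 \<in> G" by simp
next
  fix g h assume "g \<in> G" "h \<in> G"
  then obtain u v where u: "u \<in> A" "g = zero_ext (topspace H) (\<lambda>f x. u x (f x))"
    and v: "v \<in> A" "h = zero_ext (topspace H) (\<lambda>f x. v x (f x))"
    by (metis G_carrierE)
  have "zero_ext (topspace H) (\<lambda>f x. (u + v) x (f x)) \<in> G"
    using complex_vector.subspace_add[OF subspace_A u(1) v(1)] by (rule G_carrierI)
  moreover have "zero_ext (topspace H) (\<lambda>f x. (u + v) x (f x)) = g + h"
    by (simp add: u v zero_ext_def fun_eq_iff)
  ultimately show "g + h \<in> G" by simp
next
  fix c g assume "g \<in> G"
  then obtain u where u: "u \<in> A" "g = zero_ext (topspace H) (\<lambda>f x. u x (f x))"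
    by (metis G_carrierE)
  have "zero_ext (topspace H) (\<lambda>f x. (c *\<^sub>C u) x (f x)) \<in> G"
    using complex_vector.subspace_scale[OF subspace_A u(1)] by (rule G_carrierI)
  moreover have "zero_ext (topspace H) (\<lambda>f x. (c *\<^sub>C u) x (f x)) = c *\<^sub>C g"
    by (simp add: u zero_ext_def fun_eq_iff scaleC_fun_def)
  ultimately show "c *\<^sub>C g \<in> G" by simp
qed

text \<open>Makes the cut-off at the carrier of H agree, along the injection, with the cut-off at
  the carrier of \<open>E x\<close>.\<close>

lemma inj_coord_in_H_iff:
  assumes "x \<in> X"
  shows "inj_coord x v \<in> topspace H \<longleftrightarrow> v \<in> topspace (E x)"
proof
  assume "inj_coord x v \<in> topspace H"
  then have "inj_coord x v x \<in> topspace (E x)"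
    using H_subset assms by (auto simp: prod_space_def)
  then show "v \<in> topspace (E x)"
    by (simp add: inj_coord_def)
qed (use inj_H[OF assms] in auto)

text \<open>Elements of \<open>G\<close> are block diagonal, with the members of the family u as
  blocks. Off the carrier of \<open>E x\<close> both sides are 0.\<close>

lemma coord_block_eq:
  assumes "u \<in> A" "x \<in> X"
  shows "coord_block x (zero_ext (topspace H) (\<lambda>f y. u y (f y))) = u x"
proof
  fix v
  have "u x \<in> L_space (E x)"
    using assms A_subset by (auto simp: prod_space_def)
  then show "coord_block x (zero_ext (topspace H) (\<lambda>f y. u y (f y))) v = u x v"
    by (simp add: L_space_def End_space_def coord_block_def Proj_def zero_ext_def
        inj_coord_in_H_iff[OF assms(2)])
      (simp add: inj_coord_def)
qed

text \<open>Needed because \<open>prod_space\<close> demands the value 0 at indices outside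
  X.\<close>

lemma coord_block_outside:
  assumes "g \<in> G" "x \<notin> X"
  shows "coord_block x g = 0"
proof -
  obtain u where u: "u \<in> A" "g = zero_ext (topspace H) (\<lambda>f x. u x (f x))"
    using assms(1) by (rule G_carrierE)
  have "u x = 0"
    using u(1) A_subset assms(2) by (auto simp: prod_space_def)
  then show ?thesis
    by (simp add: u coord_block_def Proj_def zero_ext_def fun_eq_iff)
qed

lemma coord_block_in_\<tau>:
  "g \<in> G \<Longrightarrow> x \<in> X \<Longrightarrow> coord_block x g \<in> topspace (\<tau> x)"
  using A_subset by (auto elim!: G_carrierE simp: coord_block_eq topspace_\<tau> prod_space_def)

text \<open>A block diagonal operator is determined by its diagonal blocks; this is the joint
  injectivity of the compressions.\<close>

lemma G_carrier_eqI:
  assumes "g \<in> G" "h \<in> G" "\<And>x. x \<in> X \<Longrightarrow> coord_block x g = coord_block x h"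
  shows "g = h"
proof -
  obtain u v where u: "u \<in> A" "g = zero_ext (topspace H) (\<lambda>f x. u x (f x))"
    and v: "v \<in> A" "h = zero_ext (topspace H) (\<lambda>f x. v x (f x))"
    using assms(1,2) by (metis G_carrierE)
  have "u x = v x" for x
  proof (cases "x \<in> X")
    case True
    then show ?thesis
      using assms(3)[OF True] by (simp add: u v coord_block_eq)
  next
    case False
    then show ?thesis
      using subsetD[OF A_subset u(1)] subsetD[OF A_subset v(1)] by (simp add: prod_space_def)
  qed
  then show ?thesis
    by (simp add: u v)
qed

text \<open>Exhibits \<open>h_map H x f\<close> as block diagonal with f as its single block, the
  form in which membership in \<open>G\<close> is read off. On the right \<open>inj_coord\<close>
  injects an operator, whereas in \<open>h_map\<close> it injects a vector.\<close>

lemma h_map_eq: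
  "h_map H x f = zero_ext (topspace H) (\<lambda>v y. inj_coord x f y (v y))"
  by (auto simp: h_map_def zero_ext_def inj_coord_def Proj_def fun_eq_iff)

lemma inj_coord_in_A: "x \<in> X \<Longrightarrow> f \<in> L_space (E x) \<Longrightarrow> inj_coord x f \<in> A"
  using inj_A by blast

lemma h_map_in_G: "x \<in> X \<Longrightarrow> h_map H x \<in> topspace (\<tau> x) \<rightarrow> G"
  by (auto simp: topspace_\<tau> h_map_eq inj_coord_in_A intro!: G_carrierI)

lemma topspace_G_top: "topspace G_top = G"
  using lcs_finest_lcs_topology[of G X "h_map H" \<tau>, OF subspace_G h_map_in_G]
  by (simp add: G_topology_def lcs_topologies_for_def)

lemma continuous_map_coord_block:
  assumes x: "x \<in> X"
  shows "continuous_map G_top (\<tau> x) (coord_block x)"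
  unfolding G_topology_def
proof (rule continuous_map_finest_lcs_topology[OF subspace_G _ clinear_on_coord_block])
  show lcs: "lcs (\<tau> x)"
    using hlcs_\<tau>[OF x] by (simp add: hlcs_def)
  show "coord_block x ` G \<subseteq> topspace (\<tau> x)"
    using coord_block_in_\<tau> x by auto
  fix y assume y: "y \<in> X"
  show "h_map H y \<in> topspace (\<tau> y) \<rightarrow> G"
    by (rule h_map_in_G[OF y])
  \<comment> \<open>The family \<open>inj_coord y f\<close> has its only entry at y; reading it at x
    covers y = x and y \<noteq> x in one formula.\<close>
  have eq: "coord_block x (h_map H y f) = inj_coord y f x" if "f \<in> topspace (\<tau> y)" for f
    using that y x by (simp add: topspace_\<tau> h_map_eq coord_block_eq inj_coord_in_A)
  have "continuous_map (\<tau> y) (\<tau> x) (\<lambda>f. inj_coord y f x)"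
  proof (cases "x = y")
    case True
    then show ?thesis by (simp add: inj_coord_def)
  next
    case False
    then show ?thesis
      using complex_vector.subspace_0[OF lcs_subspace[OF lcs]] by (simp add: inj_coord_def)
  qed
  then show "continuous_map (\<tau> y) (\<tau> x) (coord_block x \<circ> h_map H y)"
    by (rule continuous_map_eq) (simp add: eq)
qed

lemma dual_space_\<tau>_separates:
  assumes "x \<in> X" "f \<in> topspace (\<tau> x)" "g \<in> topspace (\<tau> x)"
    and "\<And>\<phi>. \<phi> \<in> dual_space (\<tau> x) \<Longrightarrow> \<phi> f = \<phi> g"
  shows "f = g"
  by (rule dual_space_separates[OF hlcs_\<tau>[OF assms(1)] seminorms_\<tau>[OF assms(1)] assms(2-4)])

text \<open>No Hausdorff property or seminorms of \<open>G_top\<close> are at hand, so the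
  functionals are pulled back from the spaces \<tau> x along the coordinate blocks.\<close>

lemma dual_space_G_top_separates:
  assumes g: "g \<in> topspace G_top" and h: "h \<in> topspace G_top"
    and eq: "\<And>\<phi>. \<phi> \<in> dual_space G_top \<Longrightarrow> \<phi> g = \<phi> h"
  shows "g = h"
proof (rule G_carrier_eqI)
  show G: "g \<in> G" "h \<in> G"
    using g h by (simp_all add: topspace_G_top)
  fix x assume x: "x \<in> X"
  show "coord_block x g = coord_block x h"
  proof (rule dual_space_\<tau>_separates[OF x])
    fix \<phi> assume "\<phi> \<in> dual_space (\<tau> x)"
    then have "zero_ext (topspace G_top) (\<phi> \<circ> coord_block x) \<in> dual_space G_top"
      using dual_space_compose[OF _ clinear_on_coord_block continuous_map_coord_block[OF x]]
      by (simp add: topspace_G_top subspace_G)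
    from eq[OF this] show "\<phi> (coord_block x g) = \<phi> (coord_block x h)"
      using g h by (simp add: zero_ext_def)
  qed (use G coord_block_in_\<tau> x in auto)
qed

section \<open>Integrals of coordinate blocks and the final statement\<close>

text \<open>A coordinate block is continuous and linear, so it maps the weak integral of F to a weak
  integral of its image. Both duals separate points, which turns this into an equality of the two
  chosen integrals.\<close>

lemma Psi_L1_space:
  assumes F: "F \<in> L1_space Y G_top \<mu>" and x: "x \<in> X"
  shows "Psi F x \<in> L1_space Y (\<tau> x) \<mu>"
    and "weak_integral Y (\<tau> x) \<mu> (Psi F x) = coord_block x (weak_integral Y G_top \<mu> F)"
proof -
  have S: "complex_vector.subspace (topspace G_top)"
    by (simp add: topspace_G_top subspace_G)
  note comp = L1_space_compose[OF S clinear_on_coord_block continuous_map_coord_block[OF x] F]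
  show "Psi F x \<in> L1_space Y (\<tau> x) \<mu>"
    unfolding Psi_eq_coord_block by (rule comp(2))
  obtain I where I: "is_weak_integral Y G_top \<mu> F I"
    using F by (auto simp: L1_space_def)
  have "weak_integral Y G_top \<mu> F = I"
    using I dual_space_G_top_separates by (rule weak_integral_eqI)
  moreover have "weak_integral Y (\<tau> x) \<mu> (Psi F x) = coord_block x I"
    unfolding Psi_eq_coord_block
    using comp(1)[OF I] dual_space_\<tau>_separates[OF x] by (rule weak_integral_eqI)
  ultimately show "weak_integral Y (\<tau> x) \<mu> (Psi F x) = coord_block x (weak_integral Y G_top \<mu> F)"
    by simp
qed

lemma Psi_in_prod_space:
  assumes F: "F \<in> L1_space Y G_top \<mu>"
  shows "Psi F \<in> prod_space X (\<lambda>x. L1_space Y (\<tau> x) \<mu>)"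
proof -
  \<comment> \<open>Points off Y are included, since F is 0 there; the block of F s at an index
    outside X then vanishes for every s.\<close>
  have "F s \<in> G" for s
    using F complex_vector.subspace_0[OF subspace_G]
    by (cases "s \<in> topspace Y") (auto simp: L1_space_def topspace_G_top)
  then have "Psi F x = 0" if "x \<notin> X" for x
    using that by (simp add: Psi_eq_coord_block fun_eq_iff coord_block_outside)
  then show ?thesis
    using Psi_L1_space(1)[OF F] by (simp add: prod_space_def)
qed

end

theorem theorem2p3p23:
  fixes X :: "'x set"
    and Y :: "'y topology"
    and \<mu> :: "('y \<Rightarrow> complex) \<Rightarrow> complex"
    and E :: "'x \<Rightarrow> 'v::complex_vector topology"
    and NE :: "'x \<Rightarrow> ('v \<Rightarrow> real) set"
    and \<tau> :: "'x \<Rightarrow> ('v \<Rightarrow> 'v) topology"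
    and N\<tau> :: "'x \<Rightarrow> (('v \<Rightarrow> 'v) \<Rightarrow> real) set"
    and H :: "('x \<Rightarrow> 'v) topology"
    and A :: "('x \<Rightarrow> 'v \<Rightarrow> 'v) set"
  assumes "consistent_data X Y \<mu> E NE \<tau> N\<tau> H A"
  defines "\<GG> \<equiv> G_topology X E \<tau> H A"
  shows "(Psi ` L1_space Y \<GG> \<mu> \<subseteq> prod_space X (\<lambda>x. L1_space Y (\<tau> x) \<mu>) \<and>
          clinear_on (L1_space Y \<GG> \<mu>) Psi) \<and>
         (\<forall>x\<in>X. \<forall>F\<in>L1_space Y \<GG> \<mu>.
            weak_integral Y (\<tau> x) \<mu> (Proj x (Psi F)) =
            Proj x \<circ> weak_integral Y \<GG> \<mu> F \<circ> inj_coord x)"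
proof -
  interpret consistent_data X Y \<mu> E NE \<tau> N\<tau> H A by fact
  show ?thesis
    unfolding \<GG>_def
    using Psi_in_prod_space Psi_L1_space(2) clinear_on_Psi
    \<comment> \<open>The instance of \<open>Proj_def\<close> evaluates only the projection of
      \<open>Psi F\<close> and leaves \<open>Proj x\<close> inside the composition intact.\<close>
    by (auto simp: Proj_def[of _ "Psi _"] coord_block_def)
qed

end
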